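(* Let $d\ge 1$, let $n_1,\dots,n_d$ be positive integers, ${\bf n}=\prod_{i=1}^d n_i$, and let $x\in\mathbb{R}^{{\bf n}}$. Consider the following iteration: set $x(0)=x$; for $k=1,2,\dots$, if $x(k-1)\neq 0$, take a least square approximated Kronecker product decomposition $a_k\, x_1^k\otimes\cdots\otimes x_d^k$ of $x(k-1)$ with respect to $n_1\times\cdots\times n_d$ and set $$x(k)=x(k-1)-a_k\, x_1^k\otimes\cdots\otimes x_d^k ;$$ stop when $x(k)=0$. Then the iteration stops after finitely many steps.
   Context: For a nonzero vector $y$, its head index is $e(y)=\min\{s: y_s\neq0\}$ and its head value is $h_0(y)=y_{e(y)}$. For $y\in\mathbb{R}^{{\bf n}}$, $y\ne 0$, ${\bf n}=\prod_{i=1}^d n_i$, a least square approximated Kronecker product decomposition of $y$ with respect to $n_1\times\cdots\times n_d$ is defined as follows. Let $e=e(y)$, $h_0=h_0(y)$, $y_0=y/h_0$, and let $(e_1,\dots,e_d)$ with $1\le e_i\le n_i$ be the unique multi-index with $$e=(e_1-1)n_2\cdots n_d+(e_2-1)n_3\cdots n_d+\cdots+(e_{d-1}-1)n_d+e_d .$$ Candidate component vectors are $$y_i=(\underbrace{0,\dots,0}_{e_i-1},1,u^i_1,\dots,u^i_{n_i-e_i})^{\mathrm T}\in\mathbb{R}^{n_i},\qquad i=1,\dots,d,$$ with free real parameters $u=(u^i_j)$. The square error is $E(u)=\|y_0-y_1\otimes\cdots\otimes y_d\|^2$ (Euclidean norm). The approximated decomposition is $h_0\,y_1\otimes\cdots\otimes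 y_d$, where $u$ minimizes $E$ over all parameter values. Thus in the iteration $a_k=h_0(x(k-1))$ and $x^k_i$ are the corresponding candidate vectors for $y=x(k-1)$. Here $\otimes$ is the Kronecker product. *)

theory Defs
  imports Complex_Main "Jordan_Normal_Form.Matrix"
begin

(* All indices are 0-based: the head index, the multi-index and the positions in the list of
   dimensions are each one less than in the usual 1-based convention. *)

definition head_index :: "real vec \<Rightarrow> nat" where
  "head_index y = (LEAST s. s < dim_vec y \<and> y $ s \<noteq> 0)"

definition head_value :: "real vec \<Rightarrow> real" where
  "head_value y = y $ head_index y"

definition kron :: "real vec \<Rightarrow> real vec \<Rightarrow> real vec" where
  "kron a b = vec (dim_vec a * dim_vec b) (\<lambda>k. a $ (k div dim_vec b) * b $ (k mod dim_vec b))"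

fun kron_list :: "real vec list \<Rightarrow> real vec" where
  "kron_list [] = vec 1 (\<lambda>_. 1)"
| "kron_list (y # ys) = kron y (kron_list ys)"

definition flat_index :: "nat list \<Rightarrow> nat list \<Rightarrow> nat" where
  "flat_index ns es = (\<Sum>i<length ns. es ! i * (\<Prod>j\<in>{i<..<length ns}. ns ! j))"

definition is_multi_index :: "nat list \<Rightarrow> nat list \<Rightarrow> bool" where
  "is_multi_index ns es \<longleftrightarrow> length es = length ns \<and> (\<forall>i<length ns. es ! i < ns ! i)"

definition multi_index :: "nat list \<Rightarrow> nat \<Rightarrow> nat list" where
  "multi_index ns e = (THE es. is_multi_index ns es \<and> flat_index ns es = e)"

(* Only the values u 1, ..., u (n - e - 1) are used: these are the n - e - 1 free parameters. *)
definition candidate_vec :: "nat \<Rightarrow> nat \<Rightarrow> (nat \<Rightarrow> real) \<Rightarrow> real vec" where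
  "candidate_vec n e u = vec n (\<lambda>j. if j < e then 0 else if j = e then 1 else u (j - e))"

definition candidates :: "nat list \<Rightarrow> real vec \<Rightarrow> (nat \<Rightarrow> nat \<Rightarrow> real) \<Rightarrow> real vec list" where
  "candidates ns y u =
     map (\<lambda>i. candidate_vec (ns ! i) (multi_index ns (head_index y) ! i) (u i)) [0..<length ns]"

definition square_error :: "nat list \<Rightarrow> real vec \<Rightarrow> (nat \<Rightarrow> nat \<Rightarrow> real) \<Rightarrow> real" where
  "square_error ns y u =
     (let r = (1 / head_value y) \<cdot>\<^sub>v y - kron_list (candidates ns y u) in r \<bullet> r)"

definition ls_kron_decomposition :: "nat list \<Rightarrow> real vec \<Rightarrow> real \<Rightarrow> real vec list \<Rightarrow> bool" where
  "ls_kron_decomposition ns y a ys \<longleftrightarrow>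
     a = head_value y \<and>
     (\<exists>u. ys = candidates ns y u \<and> (\<forall>u'. square_error ns y u \<le> square_error ns y u'))"


(* Well-definedness: multi-indices exist uniquely, and a least square approximated decomposition
   of a nonzero vector always exists. *)

lemma flat_index_Nil: "flat_index [] es = 0"
  by (simp add: flat_index_def)

lemma prod_nth_eq_prod_list: "(\<Prod>j<length ns. ns ! j) = prod_list (ns :: nat list)"
  by (induction ns) (simp_all add: prod.lessThan_Suc_shift del: prod.lessThan_Suc)

lemma flat_index_Cons:
  "flat_index (n # ns) (e # es) = e * prod_list ns + flat_index ns es"
proof -
  have p: "(\<Prod>j\<in>{Suc i<..<Suc m}. f j) = (\<Prod>j\<in>{i<..<m}. f (Suc j))"
    for i m and f :: "nat \<Rightarrow> nat"
    using prod.atLeast_Suc_lessThan_Suc_shift[of f "Suc i" m]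
    by (simp only: o_def flip: atLeastSucLessThan_greaterThanLessThan)
  have "(\<Prod>j\<in>{0<..<Suc m}. f j) = (\<Prod>j<m. f (Suc j))" for m and f :: "nat \<Rightarrow> nat"
    using prod.atLeast_Suc_lessThan_Suc_shift[of f 0 m]
    by (simp only: o_def atLeast0LessThan flip: atLeastSucLessThan_greaterThanLessThan)
  then have q: "(\<Prod>j\<in>{0<..<Suc (length ns)}. (n # ns) ! j) = prod_list ns"
    by (simp add: prod_nth_eq_prod_list)
  show ?thesis
    unfolding flat_index_def
    by (simp only: list.size add_Suc_right add_0_right sum.lessThan_Suc_shift p)
       (simp add: q[simplified])
qed

lemma is_multi_index_Nil: "is_multi_index [] es \<longleftrightarrow> es = []"
  by (simp add: is_multi_index_def)

lemma is_multi_index_Cons: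
  "is_multi_index (n # ns) fs \<longleftrightarrow> (\<exists>e es. fs = e # es \<and> e < n \<and> is_multi_index ns es)"
  by (cases fs) (auto simp: is_multi_index_def less_Suc_eq_0_disj)

lemma flat_index_less:
  "is_multi_index ns es \<Longrightarrow> flat_index ns es < prod_list ns"
proof (induction ns arbitrary: es)
  case Nil
  then show ?case by (simp add: flat_index_Nil)
next
  case (Cons n ns)
  then obtain e es' where es: "es = e # es'" "e < n" "is_multi_index ns es'"
    by (auto simp: is_multi_index_Cons)
  have "flat_index (n # ns) es < (e + 1) * prod_list ns"
    using Cons.IH[OF es(3)] by (simp add: es(1) flat_index_Cons)
  also have "\<dots> \<le> n * prod_list ns"
    using es(2) by (intro mult_right_mono) auto
  finally show ?case by simp
qed

lemma ex1_multi_index: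
  assumes "e < prod_list ns"
  shows "\<exists>!es. is_multi_index ns es \<and> flat_index ns es = e"
  using assms
proof (induction ns arbitrary: e)
  case Nil
  then show ?case by (auto simp: is_multi_index_Nil flat_index_Nil)
next
  case (Cons n ns)
  let ?p = "prod_list ns"
  have pos: "?p > 0" using Cons.prems by (cases "?p = 0") auto
  then obtain es where es: "is_multi_index ns es" "flat_index ns es = e mod ?p"
    using Cons.IH[of "e mod ?p"] by auto
  show ?case
  proof (rule ex1I[of _ "(e div ?p) # es"])
    show "is_multi_index (n # ns) (e div ?p # es) \<and> flat_index (n # ns) (e div ?p # es) = e"
      using es Cons.prems pos
      by (simp add: is_multi_index_Cons flat_index_Cons less_mult_imp_div_less)
  next
    fix fs assume fs: "is_multi_index (n # ns) fs \<and> flat_index (n # ns) fs = e"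
    then obtain f fs' where f: "fs = f # fs'" "f < n" "is_multi_index ns fs'"
      by (auto simp: is_multi_index_Cons)
    have e: "e = f * ?p + flat_index ns fs'" using fs f by (simp add: flat_index_Cons)
    have "flat_index ns fs' < ?p" using f(3) by (rule flat_index_less)
    then have "e div ?p = f" "e mod ?p = flat_index ns fs'" by (simp_all add: e)
    moreover have "fs' = es"
      using Cons.IH[of "e mod ?p"] es f(3) pos calculation(2) mod_less_divisor[OF pos] by metis
    ultimately show "fs = e div ?p # es" using f by simp
  qed
qed

lemma dim_kron_list: "dim_vec (kron_list ys) = prod_list (map dim_vec ys)"
  by (induction ys) (auto simp: kron_def)

lemma kron_list_flat_index:
  assumes "map dim_vec ys = ns" "is_multi_index ns es"
  shows "kron_list ys $ flat_index ns es = (\<Prod>i<length ns. (ys ! i) $ (es ! i))"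
  using assms
proof (induction ys arbitrary: ns es)
  case Nil
  then show ?case by (auto simp: flat_index_Nil)
next
  case (Cons y ys)
  obtain n ns' where ns: "ns = n # ns'" "n = dim_vec y" "map dim_vec ys = ns'"
    using Cons.prems(1) by auto
  obtain e es' where es: "es = e # es'" "e < n" "is_multi_index ns' es'"
    using Cons.prems(2) ns by (auto simp: is_multi_index_Cons)
  have lt: "flat_index ns' es' < prod_list ns'" using es(3) by (rule flat_index_less)
  have lt': "flat_index ns es < dim_vec y * prod_list ns'"
    using flat_index_less[OF Cons.prems(2)] ns by simp
  have "kron_list (y # ys) $ flat_index ns es = y $ e * kron_list ys $ flat_index ns' es'"
    using lt lt' ns(3) by (simp add: kron_def dim_kron_list) (simp add: es(1) ns(1) flat_index_Cons)
  then show ?case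
    using Cons.IH[OF ns(3) es(3)] ns es(1) by (simp add: prod.lessThan_Suc_shift del: prod.lessThan_Suc)
qed

lemma head_index_props:
  assumes "y \<in> carrier_vec n" "y \<noteq> 0\<^sub>v n"
  shows "head_index y < n" "y $ head_index y \<noteq> 0"
proof -
  have "\<exists>s. s < dim_vec y \<and> y $ s \<noteq> 0" using assms by auto
  from LeastI_ex[OF this] show "head_index y < n" "y $ head_index y \<noteq> 0"
    using assms by (auto simp: head_index_def)
qed

lemma map_dim_candidates: "map dim_vec (candidates ns y u) = ns"
  by (auto simp: candidates_def candidate_vec_def intro: nth_equalityI)

lemma common_convergent_subseq:
  fixes f :: "nat \<Rightarrow> 'a \<Rightarrow> real"
  assumes "finite I" "\<And>i. i \<in> I \<Longrightarrow> \<exists>B. \<forall>n. \<bar>f n i\<bar> \<le> B"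
  shows "\<exists>r l. strict_mono r \<and> (\<forall>i\<in>I. (\<lambda>n. f (r n) i) \<longlonglongrightarrow> l i)"
  using assms
proof (induction I)
  case empty
  show ?case by (rule exI[of _ id]) (simp add: strict_mono_def)
next
  case (insert i I)
  then obtain r l where r: "strict_mono r" "\<And>i. i \<in> I \<Longrightarrow> (\<lambda>n. f (r n) i) \<longlonglongrightarrow> l i"
    by (metis insertCI)
  obtain B where B: "\<And>n. \<bar>f n i\<bar> \<le> B" using insert.prems[of i] by auto
  obtain s where s: "strict_mono (s :: nat \<Rightarrow> nat)" "monoseq (\<lambda>n. f (r (s n)) i)"
    using seq_monosub[of "\<lambda>n. f (r n) i"] by auto
  have "Bseq (\<lambda>n. f (r (s n)) i)" by (rule BseqI'[of _ B]) (simp add: B)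
  then obtain m where m: "(\<lambda>n. f (r (s n)) i) \<longlonglongrightarrow> m"
    using Bseq_monoseq_convergent[OF _ s(2)] by (auto simp: convergent_def)
  show ?case
  proof (intro exI conjI ballI)
    show "strict_mono (r \<circ> s)" using r(1) s(1) by (rule strict_mono_o)
    fix j assume j: "j \<in> insert i I"
    show "(\<lambda>n. f ((r \<circ> s) n) j) \<longlonglongrightarrow> (l(i := m)) j"
      using m LIMSEQ_subseq_LIMSEQ[OF r(2) s(1), of j] j insert.hyps by (auto simp: o_def)
  qed
qed

lemma ls_kron_decomposition_exists:
  assumes y: "y \<in> carrier_vec (prod_list ns)" "y \<noteq> 0\<^sub>v (prod_list ns)"
  shows "\<exists>a ys. ls_kron_decomposition ns y a ys"
proof -
  let ?N = "prod_list ns" and ?d = "length ns"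
  define es where "es = multi_index ns (head_index y)"
  have es: "is_multi_index ns es"
    using theI'[OF ex1_multi_index[OF head_index_props(1)[OF y]]]
    by (simp add: es_def multi_index_def)
  define z where "z = (\<lambda>k. y $ k / head_value y)"
  define K where "K = (\<lambda>u k. kron_list (candidates ns y u) $ k)"
  define E where "E = square_error ns y"
  have dimK: "dim_vec (kron_list (candidates ns y u)) = ?N" for u
    by (simp add: dim_kron_list map_dim_candidates)
  have E: "E u = (\<Sum>k<?N. (z k - K u k)\<^sup>2)" for u
    using y(1)
    by (simp add: E_def square_error_def Let_def scalar_prod_def dimK K_def z_def
        power2_eq_square atLeast0LessThan)
  define c where "c = (\<lambda>u i j. if j < es ! i then 0 else if j = es ! i then 1 else u i (j - es ! i) :: real)"
  have K: "K u (flat_index ns js) = (\<Prod>i<?d. c u i (js ! i))" if "is_multi_index ns js" for u js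
    unfolding K_def kron_list_flat_index[OF map_dim_candidates that]
    using that
    by (intro prod.cong) (auto simp: candidates_def candidate_vec_def c_def es_def is_multi_index_def)
  define I where "I = (SIGMA i:{..<?d}. {1..<ns ! i - es ! i})"
  have fin: "finite I" by (simp add: I_def)
  have bound: "\<exists>k<?N. \<forall>u. (z k - u i j)\<^sup>2 \<le> E u" if ij: "(i, j) \<in> I" for i j
  proof -
    define js where "js = es[i := es ! i + j]"
    have len: "length es = ?d" and i: "i < ?d" and j: "j \<ge> 1" "es ! i + j < ns ! i"
      using es ij by (auto simp: is_multi_index_def I_def)
    have js: "is_multi_index ns js"
      using es i j by (auto simp: is_multi_index_def js_def nth_list_update)
    have Ku: "K u (flat_index ns js) = u i j" for u
    proof -
      have "(\<Prod>l<?d. c u l (js ! l)) = (\<Prod>l<?d. if l = i then u i j else 1)"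
        using len i j by (intro prod.cong) (auto simp: c_def js_def nth_list_update)
      also have "\<dots> = u i j" using i by (simp add: prod.delta)
      finally show ?thesis by (simp add: K[OF js])
    qed
    have lt: "flat_index ns js < ?N" using js by (rule flat_index_less)
    have "(z (flat_index ns js) - u i j)\<^sup>2 \<le> E u" for u
      unfolding E Ku[of u, symmetric]
      using lt by (intro member_le_sum[of _ _ "\<lambda>k. (z k - K u k)\<^sup>2"]) auto
    then show ?thesis using lt by blast
  qed
  define L where "L = Inf (range E)"
  have bdd: "bdd_below (range E)"
    by (rule bdd_belowI[of _ 0]) (auto simp: E intro: sum_nonneg)
  have L: "L \<le> E u" for u unfolding L_def using bdd by (intro cInf_lower) auto
  have "\<exists>u. E u < L + 1 / real (Suc n)" for n
    using cInf_lessD[of "range E" "L + 1 / real (Suc n)"] by (auto simp: L_def)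
  then obtain U where U: "\<And>n. E (U n) < L + 1 / real (Suc n)" by metis
  have EU: "E (U n) \<le> L + 1" for n
    using U[of n] by (smt (verit) divide_le_eq_1 of_nat_0_less_iff of_nat_Suc of_nat_0_le_iff)
  have "\<exists>B. \<forall>n. \<bar>case_prod (U n) p\<bar> \<le> B" if pI: "p \<in> I" for p
  proof -
    obtain i j where p: "p = (i, j)" by (cases p)
    obtain k where k: "\<And>u. (z k - u i j)\<^sup>2 \<le> E u" using bound[of i j] pI p by blast
    have "\<bar>U n i j\<bar> \<le> \<bar>z k\<bar> + sqrt (L + 1)" for n
    proof -
      have "(z k - U n i j)\<^sup>2 \<le> L + 1" using k[of "U n"] EU[of n] by linarith
      then have "\<bar>z k - U n i j\<bar> \<le> sqrt (L + 1)" by (metis real_sqrt_abs real_sqrt_le_iff)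
      then show ?thesis by linarith
    qed
    then show ?thesis using p by auto
  qed
  from common_convergent_subseq[OF fin, of "\<lambda>n. case_prod (U n)"] this
  obtain r l where r: "strict_mono r"
    and l: "\<And>p. p \<in> I \<Longrightarrow> (\<lambda>n. case_prod (U (r n)) p) \<longlonglongrightarrow> l p"
    by blast
  define v where "v = (\<lambda>i j. l (i, j))"
  have c: "(\<lambda>n. c (U (r n)) i j) \<longlonglongrightarrow> c v i j" if "i < ?d" "j < ns ! i" for i j
  proof (cases "j \<le> es ! i")
    case True
    then show ?thesis by (auto simp: c_def)
  next
    case False
    then have "(i, j - es ! i) \<in> I" using that by (auto simp: I_def)
    from l[OF this] show ?thesis using False by (simp add: c_def v_def)
  qed
  have Kc: "(\<lambda>n. K (U (r n)) k) \<longlonglongrightarrow> K v k" if "k < ?N" for k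
  proof -
    obtain js where js: "is_multi_index ns js" "flat_index ns js = k"
      using ex1_multi_index[OF \<open>k < ?N\<close>] by auto
    have "(\<lambda>n. \<Prod>i<?d. c (U (r n)) i (js ! i)) \<longlonglongrightarrow> (\<Prod>i<?d. c v i (js ! i))"
      using js(1) by (intro tendsto_prod c) (auto simp: is_multi_index_def)
    then show ?thesis using K[OF js(1)] js(2) by simp
  qed
  have "(\<lambda>n. E (U (r n))) \<longlonglongrightarrow> E v"
    unfolding E by (intro tendsto_intros Kc) auto
  moreover have "(\<lambda>n. L + 1 / real (Suc (r n))) \<longlonglongrightarrow> L"
    using LIMSEQ_subseq_LIMSEQ[OF LIMSEQ_inverse_real_of_nat_add[of L] r]
    by (simp add: o_def inverse_eq_divide)
  ultimately have "E v \<le> L"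
    using U by (intro LIMSEQ_le[of _ "E v" _ L]) (auto intro: less_imp_le)
  then have "\<forall>u. E v \<le> E u" using L order_trans by blast
  then show ?thesis unfolding ls_kron_decomposition_def E_def by blast
qed

end

(* Whatever the parameters u, the Kronecker product of the candidate vectors vanishes before the
   head index of y and equals 1 there, because flat indices are ordered lexicographically.  Hence
   each step strictly increases the head index. *)

theory Submission
  imports Defs
begin

text \<open>Place weights are nonnegative. The contrapositive is what gets used: a smaller flat
  index forces a strictly smaller digit somewhere.\<close>

lemma flat_index_mono:
  assumes "\<And>i. i < length ns \<Longrightarrow> es ! i \<le> js ! i"
  shows "flat_index ns es \<le> flat_index ns js"
  unfolding flat_index_def using assms by (intro sum_mono mult_right_mono) auto

text \<open>The entry at a flat index is a product of one coordinate per factor, so a single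
  coordinate taken before its factor's leading 1 makes it vanish.\<close>

lemma kron_list_candidates_upto_head:
  assumes y: "y \<in> carrier_vec (prod_list ns)" "y \<noteq> 0\<^sub>v (prod_list ns)"
    and k: "k \<le> head_index y"
  shows "kron_list (candidates ns y u) $ k = (if k = head_index y then 1 else 0)"
proof -
  define es where "es = multi_index ns (head_index y)"
  have es: "is_multi_index ns es" "flat_index ns es = head_index y"
    using theI'[OF ex1_multi_index[OF head_index_props(1)[OF y]]]
    by (simp_all add: es_def multi_index_def)
  obtain js where js: "is_multi_index ns js" "flat_index ns js = k"
    using ex1_multi_index[of k ns] k head_index_props(1)[OF y] by fastforce
  have prod: "kron_list (candidates ns y u) $ k =
      (\<Prod>i<length ns. (candidates ns y u ! i) $ (js ! i))"
    using kron_list_flat_index[OF map_dim_candidates js(1)] js(2) by simp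
  have entry: "(candidates ns y u ! i) $ (js ! i) =
      (if js ! i < es ! i then 0 else if js ! i = es ! i then 1 else u i (js ! i - es ! i))"
    if "i < length ns" for i
    using js(1) that by (simp add: candidates_def candidate_vec_def es_def is_multi_index_def)
  show ?thesis
  proof (cases "k = head_index y")
    case True
    then have "js = es"
      using ex1_multi_index[OF head_index_props(1)[OF y]] es js by blast
    \<comment> \<open>Every factor is read exactly at its leading 1.\<close>
    then have "(\<Prod>i<length ns. (candidates ns y u ! i) $ (js ! i)) = 1"
      using entry by (intro prod.neutral) simp
    with True prod show ?thesis by simp
  next
    case False
    \<comment> \<open>As \<open>k\<close> lies before the head index, \<open>js\<close> cannot
      dominate \<open>es\<close> digitwise, so some factor is read inside its block of
      zeros.\<close>
    then have "\<not> flat_index ns es \<le> flat_index ns js"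
      using k es(2) js(2) by simp
    then obtain i where i: "i < length ns" "js ! i < es ! i"
      using flat_index_mono[of ns es js] not_le by blast
    then have "(\<Prod>i<length ns. (candidates ns y u ! i) $ (js ! i)) = 0"
      using entry[OF i(1)] by (intro prod_zero bexI[of _ i]) simp_all
    with False prod show ?thesis by simp
  qed
qed

text \<open>Before the head index both terms vanish; at it, the leading 1 scaled by the head value
  cancels the entry of \<open>y\<close>.\<close>

lemma ls_kron_residual:
  assumes y: "y \<in> carrier_vec (prod_list ns)" "y \<noteq> 0\<^sub>v (prod_list ns)"
    and ls: "ls_kron_decomposition ns y a ys"
  shows "y - a \<cdot>\<^sub>v kron_list ys \<in> carrier_vec (prod_list ns)"
    and "s \<le> head_index y \<Longrightarrow> (y - a \<cdot>\<^sub>v kron_list ys) $ s = 0"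
proof -
  obtain u where a: "a = head_value y" and ys: "ys = candidates ns y u"
    using ls by (auto simp: ls_kron_decomposition_def)
  have dim: "dim_vec (kron_list ys) = prod_list ns"
    by (simp add: ys dim_kron_list map_dim_candidates)
  then show "y - a \<cdot>\<^sub>v kron_list ys \<in> carrier_vec (prod_list ns)"
    by (intro carrier_vecI) simp
  assume s: "s \<le> head_index y"
  then have lt: "s < prod_list ns"
    using head_index_props(1)[OF y] by simp
  have res: "(y - a \<cdot>\<^sub>v kron_list ys) $ s = y $ s - a * kron_list ys $ s"
    using lt dim by simp
  show "(y - a \<cdot>\<^sub>v kron_list ys) $ s = 0"
  proof (cases "s = head_index y")
    case True
    then show ?thesis
      unfolding res using kron_list_candidates_upto_head[OF y s, of u]
      by (simp add: a ys head_value_def)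
  next
    case False
    with s have "s < (LEAST s. s < dim_vec y \<and> y $ s \<noteq> 0)"
      by (simp add: head_index_def)
    from not_less_Least[OF this] have "y $ s = 0"
      using lt y(1) by auto
    with False show ?thesis
      unfolding res using kron_list_candidates_upto_head[OF y s, of u]
      by (simp add: ys)
  qed
qed

theorem mainTheorem2:
  fixes ns :: "nat list" and x :: "real vec" and X :: "nat \<Rightarrow> real vec"
  assumes "length ns \<ge> 1"
    and "\<And>i. i < length ns \<Longrightarrow> ns ! i > 0"
    and "x \<in> carrier_vec (prod_list ns)"
    and "X 0 = x"
    and "\<And>k. k \<ge> 1 \<Longrightarrow> X (k - 1) \<noteq> 0\<^sub>v (prod_list ns) \<Longrightarrow>
           \<exists>a ys. ls_kron_decomposition ns (X (k - 1)) a ys \<and>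
                  X k = X (k - 1) - a \<cdot>\<^sub>v kron_list ys"
  shows "\<exists>K. X K = 0\<^sub>v (prod_list ns)"
proof (rule ccontr)
  assume "\<nexists>K. X K = 0\<^sub>v (prod_list ns)"
  then have nz: "X k \<noteq> 0\<^sub>v (prod_list ns)" for k by blast
  \<comment> \<open>Each step clears at least one more leading entry, so counting cleared entries
    bounds the number of steps by the dimension.\<close>
  have inv: "X k \<in> carrier_vec (prod_list ns) \<and> (\<forall>s<k. X k $ s = 0)" for k
  proof (induction k)
    case 0
    then show ?case using assms(3,4) by simp
  next
    case (Suc k)
    obtain a ys where ls: "ls_kron_decomposition ns (X k) a ys"
      and X: "X (Suc k) = X k - a \<cdot>\<^sub>v kron_list ys"
      using assms(5)[of "Suc k"] nz by auto
    from Suc have c: "X k \<in> carrier_vec (prod_list ns)" and z: "\<forall>s<k. X k $ s = 0" by auto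
    \<comment> \<open>The next residual vanishes up to and including this head index, hence also at
      position \<open>k\<close>.\<close>
    have "k \<le> head_index (X k)"
      using z head_index_props(2)[OF c nz] not_less by blast
    then show ?case
      using ls_kron_residual[OF c nz ls] by (simp add: X)
  qed
  let ?N = "prod_list ns"
  \<comment> \<open>After \<open>?N\<close> steps all \<open>?N\<close> entries are zero, yet a
    nonzero vector has a nonzero entry at its head index, which is below \<open>?N\<close>.\<close>
  have "X ?N $ head_index (X ?N) = 0"
    using inv[of ?N] head_index_props(1)[OF _ nz] by blast
  then show False
    using head_index_props(2)[OF _ nz] inv[of ?N] by blast
qed

end
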